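(* Let $\lambda$ be an indecomposable permutation of length $\ell>1$, and let $1\le m\le n$ be integers, so that $[\lambda^m,\lambda^n]$ is an interval of the permutation pattern poset. Then $$\mathrm{EZ}(\lambda^m,\lambda^n)=(-1)^{n-m-1}\binom{n-1}{m-1}.$$
   Context: A permutation of length $n\ge 1$ is written in one-line notation $\pi=\pi_1\cdots\pi_n$, and $|\pi|=n$. An occurrence of $\sigma$ in $\pi$ is a subsequence of $\pi$ (a choice of positions) whose letters are in the same relative order of size as the letters of $\sigma$; the permutation pattern poset has $\sigma\le\pi$ iff there is an occurrence of $\sigma$ in $\pi$. The direct sum $\sigma\oplus\pi$ is obtained by appending $\pi$ to $\sigma$ after adding $|\sigma|$ to each letter of $\pi$. A permutation is decomposable if it is the direct sum of two or more non-empty permutations, and indecomposable otherwise. For an indecomposable $\lambda$, $\lambda^n:=\lambda\oplus\cdots\oplus\lambda$ ($n$ copies). An adjacency in a permutation $\pi$ is a maximal sequence (of length $\ge 1$) of letters in consecutive positions that have consecutive values and are increasing or decreasing. The adjacencies partition the positions of $\pi$. An embedding $\eta$ of $\sigma$ in $\pi$ is a sequence of length $|\pi|$ whose nonzero letters are the letters of an occurrence of $\sigma$ in $\pi$, in the same positions as in $\pi$, all other entries being $0$. Two embeddings of $\sigma$ in $\pi$ are equivalent if they differ only within adjacencies of $\pi$, i.e. for every adjacency of $\pi$ they have the same number of nonzero entries among the positions of that adjacency. $\widehat{E}^{\sigma,\pi}$ is the set consisting of the rightmost embedding of each equivalence class, i.e. the one whose nonzero entries within each adjacency occupy the last positions of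 that adjacency. For $\eta\in\widehat{E}^{\sigma,\pi}$ let $Z(\eta)=\{i:\eta_i=0\}$. $\mathrm{EZ}^{\sigma,\pi}$ is the set of all nonempty subsets $S\subseteq\widehat{E}^{\sigma,\pi}$ with $\bigcap_{\eta\in S}Z(\eta)=\emptyset$, and $\mathrm{EZ}(\sigma,\pi):=\sum_{S\in\mathrm{EZ}^{\sigma,\pi}}(-1)^{|S|}$. *)

theory Defs
  imports Complex_Main "HOL-Combinatorics.Multiset_Permutations"
begin

text \<open>Permutations are lists over \<open>{1..n}\<close> in one-line notation. Letters are
  1-based, but positions are list indices and hence 0-based.\<close>

definition is_perm :: "nat list \<Rightarrow> bool" where
  "is_perm p \<longleftrightarrow> p \<noteq> [] \<and> p \<in> permutations_of_set {1..length p}"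

definition order_iso :: "nat list \<Rightarrow> nat list \<Rightarrow> bool" where
  "order_iso xs ys \<longleftrightarrow> length xs = length ys \<and>
     (\<forall>i<length xs. \<forall>j<length xs. xs ! i < xs ! j \<longleftrightarrow> ys ! i < ys ! j)"

definition occurrence :: "nat list \<Rightarrow> nat list \<Rightarrow> nat set \<Rightarrow> bool" where
  "occurrence s p P \<longleftrightarrow> P \<subseteq> {..<length p} \<and> order_iso s (nths p P)"

definition pattern_le :: "nat list \<Rightarrow> nat list \<Rightarrow> bool" where
  "pattern_le s p \<longleftrightarrow> (\<exists>P. occurrence s p P)"

definition dsum :: "nat list \<Rightarrow> nat list \<Rightarrow> nat list" where
  "dsum s p = s @ map (\<lambda>x. x + length s) p"

text \<open>The empty list only serves as the neutral element of the direct sum.\<close>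

definition dsum_list :: "nat list list \<Rightarrow> nat list" where
  "dsum_list ps = foldr dsum ps []"

definition decomposable :: "nat list \<Rightarrow> bool" where
  "decomposable p \<longleftrightarrow> (\<exists>ps. length ps \<ge> 2 \<and> (\<forall>q\<in>set ps. is_perm q) \<and> p = dsum_list ps)"

definition dsum_power :: "nat list \<Rightarrow> nat \<Rightarrow> nat list" where
  "dsum_power p n = dsum_list (replicate n p)"

definition adj_run :: "nat list \<Rightarrow> nat set \<Rightarrow> bool" where
  "adj_run p A \<longleftrightarrow> (\<exists>a b. a \<le> b \<and> b < length p \<and> A = {a..b} \<and>
     ((\<forall>i\<in>{a..<b}. p ! Suc i = Suc (p ! i)) \<or> (\<forall>i\<in>{a..<b}. p ! i = Suc (p ! Suc i))))"

definition adjacency :: "nat list \<Rightarrow> nat set \<Rightarrow> bool" where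
  "adjacency p A \<longleftrightarrow> adj_run p A \<and> (\<forall>B. adj_run p B \<and> A \<subseteq> B \<longrightarrow> B = A)"

definition embeddings :: "nat list \<Rightarrow> nat list \<Rightarrow> nat list set" where
  "embeddings s p =
     {map (\<lambda>i. if i \<in> P then p ! i else 0) [0..<length p] | P. occurrence s p P}"

definition embedding_equiv :: "nat list \<Rightarrow> nat list \<Rightarrow> (nat list \<times> nat list) set" where
  "embedding_equiv s p = {(e, f). e \<in> embeddings s p \<and> f \<in> embeddings s p \<and>
     (\<forall>A. adjacency p A \<longrightarrow> card {i\<in>A. e ! i \<noteq> 0} = card {i\<in>A. f ! i \<noteq> 0})}"

definition rightmost :: "nat list \<Rightarrow> nat list \<Rightarrow> bool" where
  "rightmost p e \<longleftrightarrow>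
     (\<forall>A. adjacency p A \<longrightarrow> (\<forall>i\<in>A. \<forall>j\<in>A. i < j \<and> e ! i \<noteq> 0 \<longrightarrow> e ! j \<noteq> 0))"

definition rightmost_embeddings :: "nat list \<Rightarrow> nat list \<Rightarrow> nat list set" where
  "rightmost_embeddings s p =
     {e. \<exists>C \<in> embeddings s p // embedding_equiv s p. e \<in> C \<and> rightmost p e}"

definition zeros :: "nat list \<Rightarrow> nat set" where
  "zeros e = {i. i < length e \<and> e ! i = 0}"

definition EZ_sets :: "nat list \<Rightarrow> nat list \<Rightarrow> nat list set set" where
  "EZ_sets s p = {S. S \<subseteq> rightmost_embeddings s p \<and> S \<noteq> {} \<and> (\<Inter>e\<in>S. zeros e) = {}}"

definition EZ :: "nat list \<Rightarrow> nat list \<Rightarrow> int" where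
  "EZ s p = (\<Sum>S\<in>EZ_sets s p. (- 1) ^ card S)"

lemma dsum_power_Suc: "dsum_power p (Suc n) = dsum p (dsum_power p n)"
  by (simp add: dsum_power_def dsum_list_def)

lemma take_dsum_power:
  "m \<le> n \<Longrightarrow> take (length (dsum_power p m)) (dsum_power p n) = dsum_power p m"
proof (induction m arbitrary: n)
  case 0
  then show ?case by (simp add: dsum_power_def dsum_list_def)
next
  case (Suc m)
  then obtain k where "n = Suc k" "m \<le> k" by (cases n) auto
  with Suc.IH[of k] show ?case
    by (simp add: dsum_power_Suc dsum_def take_map)
qed

lemma dsum_power_pattern_le:
  assumes "m \<le> n"
  shows "pattern_le (dsum_power p m) (dsum_power p n)"
proof -
  let ?q = "dsum_power p m" and ?r = "dsum_power p n"
  have t: "take (length ?q) ?r = ?q" using assms by (rule take_dsum_power)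
  then have "length ?q \<le> length ?r" by (metis length_take min.cobounded1 min.commute)
  then have "occurrence ?q ?r {..<length ?q}"
    using t by (simp add: occurrence_def order_iso_def)
  then show ?thesis unfolding pattern_le_def by blast
qed

end

theory Submission
  imports Defs
begin

text \<open>Since \<open>\<lambda>\<close> is indecomposable, each summand of \<open>\<lambda>\<^sup>m\<close> has to occur inside a single summand
  of \<open>\<lambda>\<^sup>n\<close>, which it then fills completely. So the embeddings correspond to the \<open>m\<close>-subsets of the
  \<open>n\<close> summands. As \<open>\<lambda>\<close> cannot start with 1, no adjacency of \<open>\<lambda>\<^sup>n\<close> crosses a border between
  summands, so every embedding is rightmost. Hence EZ is the signed count of the families of
  \<open>m\<close>-subsets that cover an \<open>n\<close>-set. The signed count of all families of \<open>m\<close>-subsets of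
  a set \<open>T\<close> is 1 if \<open>T\<close> has fewer than \<open>m\<close> elements and 0 otherwise; Moebius inversion over the
  subsets then leaves an alternating partial sum of binomial coefficients.\<close>

section \<open>Covering families of subsets of a fixed size\<close>

text \<open>Expanding the product of the factors \<open>1 - 1\<close> over \<open>K\<close> yields
  one signed term per subset; only an empty product does not vanish.\<close>

lemma sum_alternating_Pow:
  assumes "finite K"
  shows "(\<Sum>S\<in>Pow K. (- 1) ^ card S) = (if K = {} then 1 else 0 :: int)"
proof -
  have "(\<Prod>x\<in>K. (1::int) - 1) = (\<Sum>S\<in>Pow K. (- 1) ^ card S)"
    using assms by (subst prod_diff_conv_sum) simp_all
  then show ?thesis using assms by (simp add: power_0_left)
qed

text \<open>Pascal's rule makes the sum telescope.\<close>

lemma alternating_binomial_partial_sum: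
  "(\<Sum>k\<le>j. (- 1) ^ k * int (Suc n choose k)) = (- 1) ^ j * int (n choose j)"
  by (induction j) (auto simp: algebra_simps)

lemma sum_Pow_by_card:
  fixes h :: "nat \<Rightarrow> int"
  assumes "finite X"
  shows "(\<Sum>T\<in>Pow X. h (card T)) = (\<Sum>k\<le>card X. int (card X choose k) * h k)"
proof -
  have "(\<Sum>T\<in>Pow X. h (card T)) = (\<Sum>k\<le>card X. \<Sum>T | T \<in> Pow X \<and> card T = k. h (card T))"
    using assms by (subst sum.group) (auto intro: card_mono)
  also have "\<dots> = (\<Sum>k\<le>card X. int (card X choose k) * h k)"
    using n_subsets[OF assms] by (intro sum.cong) auto
  finally show ?thesis .
qed

text \<open>Sorting the families of subsets of \<open>T\<close> by their union gives
  \<open>?g T = sum ?f (Pow T)\<close>, so \<open>?f\<close> is the Moebius inverse of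
  \<open>?g\<close>.\<close>

lemma sum_covering_families:
  fixes X :: "'a set"
  assumes "finite X" and X: "card X = Suc n"
  shows "(\<Sum>S | S \<subseteq> {A. A \<subseteq> X \<and> card A = Suc m} \<and> \<Union>S = X. (- 1) ^ card S) =
           (- 1) ^ (Suc n + m) * int (n choose m)"
proof -
  let ?K = "\<lambda>T::'a set. {A. A \<subseteq> T \<and> card A = Suc m}"
  let ?f = "\<lambda>U. \<Sum>S | S \<subseteq> ?K U \<and> \<Union>S = U. (- 1 :: int) ^ card S"
  let ?g = "\<lambda>T. \<Sum>S\<in>Pow (?K T). (- 1 :: int) ^ card S"
  have finK: "finite (?K T)" if "finite T" for T
    using that by (rule rev_finite_subset[OF finite_Pow_iff[THEN iffD2]]) auto
  have "?g T = sum ?f (Pow T)" if T: "finite T" for T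
  proof -
    have "?g T = (\<Sum>U\<in>Pow T. \<Sum>S | S \<in> Pow (?K T) \<and> \<Union>S = U. (- 1) ^ card S)"
      using finK[OF T] T by (subst sum.group) auto
    also have "\<dots> = sum ?f (Pow T)"
      by (intro sum.cong refl arg_cong2[where f = sum]) auto
    finally show ?thesis .
  qed
  from inclusion_exclusion_mobius[of ?g ?f, OF this \<open>finite X\<close>]
  have "?f X = (\<Sum>T\<in>Pow X. (- 1) ^ (card X - card T) * ?g T)" .
  also have "\<dots> = (\<Sum>T\<in>Pow X. (- 1) ^ (card X - card T) * (if card T \<le> m then 1 else 0))"
  proof (intro sum.cong refl arg_cong2[where f = "(*)"])
    fix T assume "T \<in> Pow X"
    then have T: "finite T" using \<open>finite X\<close> finite_subset by auto
    \<comment> \<open>Without any set of size \<open>Suc m\<close>, the empty family alone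
      contributes 1.\<close>
    have "?K T = {} \<longleftrightarrow> card T \<le> m"
    proof
      show "card T \<le> m" if "?K T = {}"
      proof (rule ccontr)
        assume "\<not> card T \<le> m"
        then have "Suc m \<le> card T" by simp
        then show False using obtain_subset_with_card_n that by blast
      qed
      show "?K T = {}" if "card T \<le> m"
      proof -
        have "card A \<le> m" if "A \<subseteq> T" for A
          using card_mono[OF T that] \<open>card T \<le> m\<close> by simp
        then show ?thesis by (metis (mono_tags, lifting) Collect_empty_eq not_less_eq_eq order_refl)
      qed
    qed
    then show "?g T = (if card T \<le> m then 1 else 0)"
      using sum_alternating_Pow[OF finK[OF T]] by simp
  qed
  also have "\<dots> = (\<Sum>k\<le>Suc n. int (Suc n choose k) * ((- 1) ^ (Suc n - k) * (if k \<le> m then 1 else 0)))"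
    using sum_Pow_by_card[OF \<open>finite X\<close>, of "\<lambda>k. (- 1) ^ (Suc n - k) * (if k \<le> m then 1 else 0)"] X
    by simp
  \<comment> \<open>As \<open>k \<le> Suc n\<close>, the subtraction in the exponent is exact and
    the sign splits.\<close>
  also have "\<dots> = (\<Sum>k\<in>{..Suc n} \<inter> {..m}. (- 1) ^ Suc n * ((- 1) ^ k * int (Suc n choose k)))"
    by (rule sum.mono_neutral_cong_right)
       (auto simp: uminus_power_if split: if_splits)
  also have "\<dots> = (\<Sum>k\<le>m. (- 1) ^ Suc n * ((- 1) ^ k * int (Suc n choose k)))"
    by (rule sum.mono_neutral_left) (auto simp del: binomial_Suc_Suc)
  also have "\<dots> = (- 1) ^ Suc n * (\<Sum>k\<le>m. (- 1) ^ k * int (Suc n choose k))"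
    by (simp only: sum_distrib_left)
  also have "\<dots> = (- 1) ^ (Suc n + m) * int (n choose m)"
    by (simp only: alternating_binomial_partial_sum power_add mult.assoc)
  finally show ?thesis .
qed

section \<open>Occurrences as increasing maps of positions\<close>

lemma nths_conv_map_sorted_list_of_set:
  assumes "P \<subseteq> {..<length p}"
  shows "nths p P = map ((!) p) (sorted_list_of_set P)"
proof -
  have "nths p P = nths (map ((!) p) [0..<length p]) P" by (simp add: map_nth)
  also have "\<dots> = map ((!) p) (nths [0..<length p] P)" by (rule nths_map)
  also have "nths [0..<length p] P = sorted_list_of_set P"
  proof (rule strict_sorted_equal)
    have "set (nths [0..<length p] P) = P" using assms by (force simp: set_nths)
    moreover have "finite P" using assms finite_subset by blast
    ultimately show "set (nths [0..<length p] P) = set (sorted_list_of_set P)" by simp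
  qed (auto simp: strict_sorted_iff distinct_nthsI sorted_nths)
  finally show ?thesis .
qed

text \<open>Replacing \<open>nths\<close> by a map \<open>f\<close> of positions makes it possible
  to ask which summand each letter of the pattern is sent to.\<close>

lemma occurrence_iff_strict_mono_on:
  "occurrence s p P \<longleftrightarrow>
     (\<exists>f. strict_mono_on {..<length s} f \<and> f ` {..<length s} = P \<and> P \<subseteq> {..<length p} \<and>
       (\<forall>i<length s. \<forall>j<length s. s ! i < s ! j \<longleftrightarrow> p ! f i < p ! f j))"
proof
  assume *: "occurrence s p P"
  then have P: "P \<subseteq> {..<length p}" by (simp add: occurrence_def)
  then have fin: "finite P" using finite_subset by blast
  let ?l = "sorted_list_of_set P"
  have iso: "order_iso s (map ((!) p) ?l)"
    using * nths_conv_map_sorted_list_of_set[OF P] by (simp add: occurrence_def)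
  then have len: "length s = length ?l" by (simp add: order_iso_def)
  have "strict_mono_on {..<length s} ((!) ?l)"
    using strict_sorted_list_of_set[of P] len
    by (auto intro!: strict_mono_onI simp: sorted_wrt_iff_nth_less)
  moreover have "(!) ?l ` {..<length s} = P"
    using fin len nth_image[of "length s" ?l] by (simp add: lessThan_atLeast0)
  moreover have "\<forall>i<length s. \<forall>j<length s. s ! i < s ! j \<longleftrightarrow> p ! (?l ! i) < p ! (?l ! j)"
    using iso len by (simp add: order_iso_def)
  ultimately show "\<exists>f. strict_mono_on {..<length s} f \<and> f ` {..<length s} = P \<and> P \<subseteq> {..<length p} \<and>
       (\<forall>i<length s. \<forall>j<length s. s ! i < s ! j \<longleftrightarrow> p ! f i < p ! f j)"
    using P by blast
next
  assume "\<exists>f. strict_mono_on {..<length s} f \<and> f ` {..<length s} = P \<and> P \<subseteq> {..<length p} \<and>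
       (\<forall>i<length s. \<forall>j<length s. s ! i < s ! j \<longleftrightarrow> p ! f i < p ! f j)"
  then obtain f where f: "strict_mono_on {..<length s} f" "f ` {..<length s} = P" "P \<subseteq> {..<length p}"
    "\<forall>i<length s. \<forall>j<length s. s ! i < s ! j \<longleftrightarrow> p ! f i < p ! f j" by blast
  \<comment> \<open>A strictly increasing map with image \<open>P\<close> can only list
    \<open>P\<close> in sorted order.\<close>
  have "sorted_list_of_set P = map f [0..<length s]"
  proof (rule strict_sorted_equal)
    show "sorted_wrt (<) (map f [0..<length s])"
      using f(1) by (auto simp: sorted_wrt_iff_nth_less strict_mono_on_def)
    have "finite P" using f(2) by auto
    then show "set (sorted_list_of_set P) = set (map f [0..<length s])"
      using f(2) by (simp add: lessThan_atLeast0)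
  qed simp
  then show "occurrence s p P"
    using f(3,4) nths_conv_map_sorted_list_of_set[OF f(3)]
    by (simp add: occurrence_def order_iso_def)
qed

section \<open>Powers of an indecomposable permutation\<close>

lemma is_perm_iff: "is_perm p \<longleftrightarrow> p \<noteq> [] \<and> distinct p \<and> set p = {1..length p}"
  by (auto simp: is_perm_def permutations_of_set_def)

lemma length_dsum_power: "length (dsum_power p n) = n * length p"
  by (induction n) (simp_all add: dsum_power_Suc dsum_def, simp add: dsum_power_def dsum_list_def)

lemma nth_dsum_power:
  assumes "i < n * length p"
  shows "dsum_power p n ! i = p ! (i mod length p) + length p * (i div length p)"
  using assms
proof (induction n arbitrary: i)
  case (Suc n)
  show ?case
  proof (cases "i < length p")
    case True
    then show ?thesis by (simp add: dsum_power_Suc dsum_def nth_append)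
  next
    case False
    then have "length p > 0" using Suc.prems by (cases p) auto
    then show ?thesis using False Suc.prems Suc.IH[of "i - length p"]
      by (simp add: dsum_power_Suc dsum_def nth_append length_dsum_power
          le_mod_geq le_div_geq)
  qed
qed simp

text \<open>Without an inversion across the cut at \<open>k\<close>, the first \<open>k\<close>
  letters would be exactly 1 to \<open>k\<close>, and the cut would split \<open>p\<close> as a
  direct sum.\<close>

lemma indecomposable_prefix_not_below:
  assumes "is_perm p" and "\<not> decomposable p" and k: "0 < k" "k < length p"
  shows "\<exists>i j. i < k \<and> k \<le> j \<and> j < length p \<and> p ! j < p ! i"
proof (rule ccontr)
  assume no_inv: "\<not> ?thesis"
  note p = assms(1)[unfolded is_perm_iff]
  have less: "p ! i < p ! j" if "i < k" "k \<le> j" "j < length p" for i j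
  proof -
    have "\<not> p ! j < p ! i" using no_inv that by blast
    moreover have "p ! i \<noteq> p ! j" using p that by (simp add: nth_eq_iff_index_eq)
    ultimately show ?thesis by simp
  qed
  have un: "set (take k p) \<union> set (drop k p) = {1..length p}"
    using p by (metis append_take_drop_id set_append)
  have lt: "x < y" if "x \<in> set (take k p)" "y \<in> set (drop k p)" for x y
    using that less k by (auto simp: in_set_conv_nth)
  have cards: "card (set (take k p)) = k" "card (set (drop k p)) = length p - k"
    using p k by (simp_all add: distinct_card)
  \<comment> \<open>All \<open>length p - k\<close> letters after the cut exceed \<open>x\<close>,
    but only \<open>length p - x\<close> values do, so \<open>x \<le> k\<close>.\<close>
  have sub: "set (take k p) \<subseteq> {1..k}"
  proof
    fix x assume x: "x \<in> set (take k p)"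
    then have "set (drop k p) \<subseteq> {x<..length p}" using lt un by auto
    then have "card (set (drop k p)) \<le> card {x<..length p}" by (intro card_mono) auto
    moreover have "1 \<le> x" "x \<le> length p" using x un by auto
    ultimately show "x \<in> {1..k}" using cards k by auto
  qed
  have low: "set (take k p) = {1..k}"
    by (rule card_subset_eq) (use sub cards in auto)
  moreover have "set (take k p) \<inter> set (drop k p) = {}" using lt by fastforce
  ultimately have "set (drop k p) = {1..length p} - {1..k}" using un by blast
  moreover have "{1..length p} - {1..k} = {k + 1..length p}" by auto
  ultimately have high: "set (drop k p) = {k + 1..length p}" by (rule trans)
  let ?q = "map (\<lambda>x. x - k) (drop k p)"
  have inj: "inj_on (\<lambda>x. x - k) {k + 1..length p}" by (auto simp: inj_on_def)
  have "set ?q = {1..length ?q}"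
  proof -
    have "x \<in> (\<lambda>x. x - k) ` {k + 1..length p}" if "x \<in> {1..length p - k}" for x
      using that k by (intro image_eqI[of _ _ "x + k"]) auto
    then have "(\<lambda>x. x - k) ` {k + 1..length p} = {1..length p - k}" by auto
    then show ?thesis using high by simp
  qed
  then have "is_perm ?q" using p k inj high by (auto simp: is_perm_iff distinct_map)
  moreover have "is_perm (take k p)" using p k low by (auto simp: is_perm_iff)
  moreover have "p = dsum_list [take k p, ?q]"
  proof -
    have "map (\<lambda>x. x - k + k) (drop k p) = map (\<lambda>x. x) (drop k p)"
      using high by (intro map_cong) auto
    then show ?thesis using k by (simp add: dsum_list_def dsum_def o_def)
  qed
  ultimately have "decomposable p"
    unfolding decomposable_def by (intro exI[of _ "[take k p, ?q]"]) simp
  then show False using assms(2) by blast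
qed

text \<open>The positions of the summands with indices in \<open>B\<close>, for summands of length \<open>l\<close>.\<close>

definition block_union :: "nat \<Rightarrow> nat \<Rightarrow> nat set \<Rightarrow> nat set" where
  "block_union l n B = {i. i < n * l \<and> i div l \<in> B}"

text \<open>Division with remainder turns a position into the index of its summand and the place
  inside it. This serves to count the positions and to recover \<open>B\<close> from them.\<close>

lemma bij_betw_block_union:
  assumes "0 < l" and B: "B \<subseteq> {..<n}"
  shows "bij_betw (\<lambda>i. (i div l, i mod l)) (block_union l n B) (B \<times> {..<l})"
proof (rule bij_betw_byWitness[where f' = "\<lambda>(b, t). b * l + t"])
  have "b * l + t < n * l" if "b \<in> B" "t < l" for b t
  proof -
    have "Suc b \<le> n" using that B by auto
    then have "Suc b * l \<le> n * l" by (rule mult_le_mono1)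
    then show ?thesis using that by simp
  qed
  then show "(\<lambda>(b, t). b * l + t) ` (B \<times> {..<l}) \<subseteq> block_union l n B"
    using assms(1) by (auto simp: block_union_def)
qed (use assms(1) in \<open>auto simp: block_union_def\<close>)

lemma card_block_union:
  assumes "0 < l" "B \<subseteq> {..<n}"
  shows "card (block_union l n B) = card B * l"
  using bij_betw_same_card[OF bij_betw_block_union[OF assms]] by (simp add: card_cartesian_product)

lemma div_image_block_union:
  assumes "0 < l" "B \<subseteq> {..<n}"
  shows "(\<lambda>i. i div l) ` block_union l n B = B"
proof -
  have "(\<lambda>i. i div l) ` block_union l n B = fst ` (\<lambda>i. (i div l, i mod l)) ` block_union l n B"
    by (simp add: image_image)
  also have "\<dots> = fst ` (B \<times> {..<l})"
    using bij_betw_block_union[OF assms] by (simp only: bij_betw_def)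
  also have "\<dots> = B" using assms(1) by force
  finally show ?thesis .
qed

lemma finite_block_union: "finite (block_union l n B)"
  by (rule finite_subset[of _ "{..<n * l}"]) (auto simp: block_union_def)

text \<open>Length above 1 excludes \<open>[1]\<close>, whose powers are increasing runs, so that a
  single adjacency contains all summands.\<close>

locale indecomposable_perm =
  fixes lam :: "nat list"
  assumes perm: "is_perm lam"
    and indec: "\<not> decomposable lam"
    and length_gt_1: "length lam > 1"
begin

abbreviation len :: nat where "len \<equiv> length lam"

lemma len_pos: "0 < len"
  using length_gt_1 by linarith

lemma nth_bounds: "i < len \<Longrightarrow> 1 \<le> lam ! i \<and> lam ! i \<le> len"
  using perm nth_mem[of i lam] by (auto simp: is_perm_iff simp del: nth_mem)

text \<open>The letters of summand \<open>c\<close> lie between \<open>len * c + 1\<close> and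
  \<open>len * c + len\<close>, so the summand index decides first and \<open>lam\<close> breaks
  ties.\<close>

lemma nth_dsum_power_less_iff:
  assumes "i < n * len" "j < n * len"
  shows "dsum_power lam n ! i < dsum_power lam n ! j \<longleftrightarrow>
    i div len < j div len \<or> i div len = j div len \<and> lam ! (i mod len) < lam ! (j mod len)"
proof -
  have *: "lam ! (a mod len) + len * (a div len) < lam ! (b mod len) + len * (b div len)"
    if "a div len < b div len" for a b
  proof -
    have "len * (a div len) + len \<le> len * (b div len)"
      using that by (metis Suc_leI mult_Suc_right mult_le_mono2 add.commute)
    then show ?thesis
      using nth_bounds[of "a mod len"] nth_bounds[of "b mod len"] len_pos by fastforce
  qed
  show ?thesis
    using *[of i j] *[of j i] assms
    by (cases "i div len" "j div len" rule: linorder_cases) (auto simp: nth_dsum_power)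
qed

text \<open>Later summands have larger letters, so only an ascent can cross a border; an ascent by
  one there needs \<open>lam ! 0 = 1\<close>.\<close>

lemma same_block_if_consecutive:
  assumes i: "Suc i < n * len"
    and adj: "dsum_power lam n ! Suc i = Suc (dsum_power lam n ! i) \<or>
      dsum_power lam n ! i = Suc (dsum_power lam n ! Suc i)"
  shows "Suc i div len = i div len"
proof (rule ccontr)
  assume ne: "Suc i div len \<noteq> i div len"
  then have dvd: "Suc i mod len = 0" "Suc i div len = Suc (i div len)"
    by (auto simp: div_Suc split: if_splits)
  let ?x = "lam ! (i mod len)"
  have x: "1 \<le> ?x" "?x \<le> len" using nth_bounds len_pos by auto
  have 0: "1 \<le> lam ! 0" using nth_bounds len_pos by auto
  have "lam ! 0 = 1"
    using adj i dvd x 0 by (auto simp: nth_dsum_power)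
  \<comment> \<open>The cut after the first letter supplies a letter below \<open>lam ! 0\<close>,
    which would have to be 0.\<close>
  moreover obtain j where "j < len" "lam ! j < lam ! 0"
    using indecomposable_prefix_not_below[OF perm indec, of 1] length_gt_1 by auto
  ultimately show False using nth_bounds[of j] by simp
qed

text \<open>Along component \<open>c\<close> the index of the target summand is weakly increasing.
  If it changed, then from the first change on all letters would exceed all earlier ones, but
  indecomposability puts an inversion across that cut.\<close>

lemma component_within_block:
  assumes f: "strict_mono_on {..<m * len} f" "f ` {..<m * len} \<subseteq> {..<n * len}"
    and iso: "\<forall>i<m * len. \<forall>j<m * len.
      dsum_power lam m ! i < dsum_power lam m ! j \<longleftrightarrow> dsum_power lam n ! f i < dsum_power lam n ! f j"
    and c: "c < m" and t: "t < len"
  shows "f (c * len + t) div len = f (c * len) div len"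
proof (rule ccontr)
  let ?g = "\<lambda>t. f (c * len + t) div len"
  assume "f (c * len + t) div len \<noteq> f (c * len) div len"
  then have ex: "?g t \<noteq> ?g 0" by simp
  define k where "k = (LEAST k. ?g k \<noteq> ?g 0)"
  have k: "?g k \<noteq> ?g 0" using ex unfolding k_def by (rule LeastI)
  have below: "?g i = ?g 0" if "i < k" for i using that not_less_Least k_def by blast
  have "k \<le> t" using ex unfolding k_def by (rule Least_le)
  then have "k < len" using t by simp
  have "0 < k" using k by (cases k) auto
  have dom: "c * len + i < m * len" if "i < len" for i
  proof -
    have "Suc c * len \<le> m * len" using c by (intro mult_le_mono1) simp
    then show ?thesis using that by simp
  qed
  have mono: "?g i \<le> ?g j" if "i \<le> j" "j < len" for i j
    using f(1) that dom
    by (intro div_le_mono) (auto simp: strict_mono_on_def le_less)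
  obtain i j where ij: "i < k" "k \<le> j" "j < len" "lam ! j < lam ! i"
    using indecomposable_prefix_not_below[OF perm indec \<open>0 < k\<close> \<open>k < len\<close>] by blast
  have "?g i < ?g j" using below[OF ij(1)] mono[OF ij(2,3)] mono[of 0 k] k \<open>k < len\<close> by simp
  moreover have "f (c * len + i) < n * len" "f (c * len + j) < n * len"
    using f(2) dom[of i] dom[of j] ij by (auto simp: image_subset_iff)
  ultimately have "dsum_power lam n ! f (c * len + i) < dsum_power lam n ! f (c * len + j)"
    by (simp add: nth_dsum_power_less_iff)
  then have "dsum_power lam m ! (c * len + i) < dsum_power lam m ! (c * len + j)"
    using iso dom ij by simp
  moreover have "i < len" using ij by simp
  ultimately show False using ij dom[of i] dom[of j] len_pos by (simp add: nth_dsum_power_less_iff)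
qed

lemma occurrence_dsum_power_iff:
  "occurrence (dsum_power lam m) (dsum_power lam n) P \<longleftrightarrow>
     (\<exists>B \<subseteq> {..<n}. card B = m \<and> P = block_union len n B)"
proof
  assume "occurrence (dsum_power lam m) (dsum_power lam n) P"
  then obtain f where f: "strict_mono_on {..<m * len} f" "f ` {..<m * len} = P" "P \<subseteq> {..<n * len}"
    and iso: "\<forall>i<m * len. \<forall>j<m * len.
      dsum_power lam m ! i < dsum_power lam m ! j \<longleftrightarrow> dsum_power lam n ! f i < dsum_power lam n ! f j"
    unfolding occurrence_iff_strict_mono_on length_dsum_power by blast
  \<comment> \<open>By \<open>component_within_block\<close>, the summands reached by the first
    letters of the components already contain all of \<open>P\<close>.\<close>
  define B where "B = (\<lambda>c. f (c * len) div len) ` {..<m}"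
  have "f i div len \<in> B" if "i < m * len" for i
  proof -
    have c: "i div len < m" using that by (simp add: less_mult_imp_div_less)
    have "f (i div len * len + i mod len) div len = f (i div len * len) div len"
      using component_within_block[OF f(1) _ iso c, of "i mod len"] f(2,3) len_pos by simp
    then show ?thesis using c by (auto simp: B_def)
  qed
  then have sub: "P \<subseteq> block_union len n B" using f(2,3) by (auto simp: block_union_def)
  have B: "B \<subseteq> {..<n}"
  proof
    fix b assume "b \<in> B"
    then obtain c where "c < m" "b = f (c * len) div len" by (auto simp: B_def)
    moreover have "f (c * len) < n * len"
      using f(2,3) \<open>c < m\<close> len_pos by (auto simp: image_subset_iff)
    ultimately show "b \<in> {..<n}" by (simp add: less_mult_imp_div_less)
  qed
  txt \<open>Counting forces the \<open>m\<close> components into distinct blocks and makes them fill these.\<close>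
  have "card P = m * len"
    using f(1,2) card_image[OF strict_mono_on_imp_inj_on[OF f(1)]] by simp
  moreover have "card B \<le> m" using card_image_le[of "{..<m}"] by (simp add: B_def)
  moreover have "card P \<le> card (block_union len n B)"
    by (rule card_mono[OF finite_block_union sub])
  ultimately have "card B = m"
    using card_block_union[OF len_pos B] len_pos by simp
  moreover have "P = block_union len n B"
    using card_block_union[OF len_pos B] \<open>card B = m\<close> \<open>card P = m * len\<close>
    by (intro card_subset_eq finite_block_union sub) simp
  ultimately show "\<exists>B \<subseteq> {..<n}. card B = m \<and> P = block_union len n B" using B by blast
next
  assume "\<exists>B \<subseteq> {..<n}. card B = m \<and> P = block_union len n B"
  then obtain B where B: "B \<subseteq> {..<n}" "card B = m" and P: "P = block_union len n B" by blast
  have finB: "finite B" using B(1) finite_subset by blast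
  define b where "b = (!) (sorted_list_of_set B)"
  have b: "b i < b j \<longleftrightarrow> i < j" "b i = b j \<longleftrightarrow> i = j" if "i < m" "j < m" for i j
    using that strict_sorted_list_of_set[of B] B(2)
    by (auto simp: b_def sorted_wrt_iff_nth_less nth_eq_iff_index_eq)
       (metis linorder_neqE_nat not_less_iff_gr_or_eq)
  have b_mem: "b i \<in> B" if "i < m" for i
    using that finB B(2) nth_mem[of i "sorted_list_of_set B"] by (simp add: b_def)
  \<comment> \<open>Each component goes to the summand of the same rank in \<open>B\<close>, and
    places inside a summand are kept.\<close>
  define f where "f i = b (i div len) * len + i mod len" for i
  have f_div: "f i div len = b (i div len)" and f_mod: "f i mod len = i mod len" for i
    using len_pos by (simp_all add: f_def)
  have dom: "i div len < m" if "i < m * len" for i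
    using that by (simp add: less_mult_imp_div_less)
  have mono: "strict_mono_on {..<m * len} f"
  proof (rule strict_mono_onI)
    fix i j assume ij: "i \<in> {..<m * len}" "j \<in> {..<m * len}" "i < j"
    then have "i div len \<le> j div len" by (simp add: div_le_mono)
    then consider "i div len < j div len" | "i div len = j div len" by linarith
    then show "f i < f j"
    proof cases
      case 1
      then have "f i div len < f j div len" using b dom ij by (simp add: f_div)
      then show ?thesis by (meson div_le_mono not_le)
    next
      case 2
      then have "i mod len < j mod len"
        using ij(3) div_mult_mod_eq[of i len] div_mult_mod_eq[of j len] by (metis add_less_cancel_left)
      then show ?thesis using 2 by (simp add: f_def)
    qed
  qed
  have "f i \<in> block_union len n B" if "i < m * len" for i
  proof -
    have "b (i div len) \<in> B" using b_mem dom that by simp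
    moreover have "f i < n * len"
      using B(1) calculation len_pos by (auto simp flip: f_div simp: div_less_iff_less_mult)
    ultimately show ?thesis by (simp add: block_union_def f_div)
  qed
  \<comment> \<open>\<open>f\<close> is injective, so its image has \<open>m * len\<close> elements,
    as many as the block union containing it.\<close>
  then have "f ` {..<m * len} = P"
    unfolding P using card_block_union[OF len_pos B(1)] B(2)
      card_image[OF strict_mono_on_imp_inj_on[OF mono]]
    by (intro card_subset_eq finite_block_union) auto
  moreover have "P \<subseteq> {..<n * len}" by (auto simp: P block_union_def)
  moreover have "dsum_power lam m ! i < dsum_power lam m ! j \<longleftrightarrow>
      dsum_power lam n ! f i < dsum_power lam n ! f j" if "i < m * len" "j < m * len" for i j
  proof -
    have "f i < n * len" "f j < n * len" using calculation that by blast+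
    then show ?thesis
      using that dom b by (simp add: nth_dsum_power_less_iff f_div f_mod)
  qed
  ultimately show "occurrence (dsum_power lam m) (dsum_power lam n) P"
    unfolding occurrence_iff_strict_mono_on length_dsum_power using mono by blast
qed

section \<open>Embeddings between powers and their zeros\<close>

definition block_embedding :: "nat \<Rightarrow> nat set \<Rightarrow> nat list" where
  "block_embedding n B =
     map (\<lambda>i. if i \<in> block_union len n B then dsum_power lam n ! i else 0) [0..<n * len]"

lemma embeddings_dsum_power:
  "embeddings (dsum_power lam m) (dsum_power lam n) =
     block_embedding n ` {B. B \<subseteq> {..<n} \<and> card B = m}"
  unfolding embeddings_def occurrence_dsum_power_iff block_embedding_def length_dsum_power
  by auto

lemma block_embedding_eq_0_iff:
  assumes "i < n * len"
  shows "block_embedding n B ! i = 0 \<longleftrightarrow> i div len \<notin> B"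
  using assms nth_bounds[of "i mod len"] len_pos
  by (auto simp: block_embedding_def block_union_def nth_dsum_power)

text \<open>An adjacency stays inside one summand, where the entries are either all zero or all
  nonzero.\<close>

lemma rightmost_block_embedding: "rightmost (dsum_power lam n) (block_embedding n B)"
  unfolding rightmost_def
proof (intro allI impI ballI)
  fix A i j
  assume "adjacency (dsum_power lam n) A" and ij: "i \<in> A" "j \<in> A"
    and lt: "i < j \<and> block_embedding n B ! i \<noteq> 0"
  then obtain a c where c: "c < n * len" and A: "A = {a..c}"
    and run: "\<forall>k\<in>{a..<c}. dsum_power lam n ! Suc k = Suc (dsum_power lam n ! k) \<or>
      dsum_power lam n ! k = Suc (dsum_power lam n ! Suc k)"
    unfolding adjacency_def adj_run_def length_dsum_power by blast
  have "k div len = i div len" if "i \<le> k" "k \<le> c" for k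
    using that
  proof (induction k rule: dec_induct)
    case (step k)
    then have "k \<in> {a..<c}" using ij A by auto
    then have "Suc k div len = k div len"
      using same_block_if_consecutive[of k n] run c step by auto
    then show ?case using step by simp
  qed simp
  moreover have "i \<le> j" "j \<le> c" "i < n * len" "j < n * len" using ij lt A c by auto
  ultimately have "j div len = i div len" by blast
  then show "block_embedding n B ! j \<noteq> 0"
    using lt \<open>i < n * len\<close> \<open>j < n * len\<close> by (metis block_embedding_eq_0_iff)
qed

text \<open>Each embedding lies in its own class and is already rightmost, so passing to rightmost
  representatives discards nothing.\<close>

lemma rightmost_embeddings_dsum_power:
  "rightmost_embeddings (dsum_power lam m) (dsum_power lam n) =
     block_embedding n ` {B. B \<subseteq> {..<n} \<and> card B = m}" (is "?R = ?E")
proof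
  show "?R \<subseteq> ?E"
    unfolding embeddings_dsum_power[symmetric]
    by (auto simp: rightmost_embeddings_def quotient_def embedding_equiv_def)
  show "?E \<subseteq> ?R"
  proof
    fix e assume "e \<in> ?E"
    then have e: "e \<in> embeddings (dsum_power lam m) (dsum_power lam n)" "rightmost (dsum_power lam n) e"
      using rightmost_block_embedding embeddings_dsum_power by auto
    let ?r = "embedding_equiv (dsum_power lam m) (dsum_power lam n)"
    have "?r `` {e} \<in> embeddings (dsum_power lam m) (dsum_power lam n) // ?r"
      using e(1) by (rule quotientI)
    moreover have "e \<in> ?r `` {e}" using e(1) by (simp add: embedding_equiv_def)
    ultimately show "e \<in> ?R" using e(2) by (auto simp: rightmost_embeddings_def)
  qed
qed

lemma zeros_block_embedding:
  "zeros (block_embedding n B) = {..<n * len} - block_union len n B"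
proof -
  have "length (block_embedding n B) = n * len" by (simp add: block_embedding_def)
  then show ?thesis
    by (auto simp: zeros_def block_embedding_eq_0_iff block_union_def)
qed

text \<open>The zero set determines the used positions, and these determine
  \<open>B\<close>.\<close>

lemma inj_on_block_embedding: "inj_on (block_embedding n) (Pow {..<n})"
proof (rule inj_onI)
  fix B C assume BC: "B \<in> Pow {..<n}" "C \<in> Pow {..<n}" "block_embedding n B = block_embedding n C"
  have "block_union len n D = {..<n * len} - zeros (block_embedding n D)" for D
    unfolding zeros_block_embedding by (auto simp: block_union_def)
  then have "block_union len n B = block_union len n C" using BC by simp
  moreover have "B \<subseteq> {..<n}" "C \<subseteq> {..<n}" using BC by auto
  ultimately show "B = C" by (metis div_image_block_union len_pos)
qed

section \<open>From EZ to covering families\<close>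

lemma EZ_sets_dsum_power:
  assumes "0 < n"
  shows "EZ_sets (dsum_power lam m) (dsum_power lam n) =
    (`) (block_embedding n) ` {S. S \<subseteq> {B. B \<subseteq> {..<n} \<and> card B = m} \<and> \<Union>S = {..<n}}"
proof -
  let ?K = "{B. B \<subseteq> {..<n} \<and> card B = m}"
  have cover: "block_embedding n ` S \<noteq> {} \<and> (\<Inter>e\<in>block_embedding n ` S. zeros e) = {} \<longleftrightarrow> \<Union>S = {..<n}"
    if S: "S \<subseteq> ?K" for S
  proof (cases "S = {}")
    \<comment> \<open>Since \<open>0 < n\<close>, the empty family does not cover
      \<open>{..<n}\<close>, in accordance with the nonemptiness demanded in
      \<open>EZ_sets\<close>.\<close>
    case True
    then show ?thesis using assms by auto
  next
    case False
    have "(\<Inter>e\<in>block_embedding n ` S. zeros e) = {..<n * len} - block_union len n (\<Union>S)"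
      using False by (auto simp: zeros_block_embedding block_union_def)
    also have "\<dots> = {} \<longleftrightarrow> \<Union>S = {..<n}"
    proof
      assume "{..<n * len} - block_union len n (\<Union>S) = {}"
      then have "block_union len n (\<Union>S) = block_union len n {..<n}"
        by (auto simp: block_union_def less_mult_imp_div_less)
      moreover have "\<Union>S \<subseteq> {..<n}" using S by auto
      ultimately show "\<Union>S = {..<n}" by (metis div_image_block_union len_pos order_refl)
    qed (auto simp: block_union_def less_mult_imp_div_less)
    finally show ?thesis using False by simp
  qed
  show ?thesis
    unfolding EZ_sets_def rightmost_embeddings_dsum_power
  proof (intro set_eqI iffI)
    fix T assume "T \<in> {S. S \<subseteq> block_embedding n ` ?K \<and> S \<noteq> {} \<and> (\<Inter>e\<in>S. zeros e) = {}}"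
    then have T: "T \<subseteq> block_embedding n ` ?K" "T \<noteq> {} \<and> (\<Inter>e\<in>T. zeros e) = {}" by simp_all
    from T(1) obtain S where S: "S \<subseteq> ?K" "T = block_embedding n ` S" by (rule subset_imageE)
    have "\<Union>S = {..<n}" using T(2) cover[OF S(1)] unfolding S(2) by (rule iffD1[rotated])
    then show "T \<in> (`) (block_embedding n) ` {S. S \<subseteq> ?K \<and> \<Union>S = {..<n}}"
      using S by (intro image_eqI[of _ _ S] CollectI conjI)
  next
    fix T assume "T \<in> (`) (block_embedding n) ` {S. S \<subseteq> ?K \<and> \<Union>S = {..<n}}"
    then obtain S where S: "S \<subseteq> ?K" "\<Union>S = {..<n}" and T: "T = block_embedding n ` S" by blast
    have "T \<noteq> {} \<and> (\<Inter>e\<in>T. zeros e) = {}" using S(2) cover[OF S(1)] unfolding T by (rule iffD2[rotated])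
    moreover have "T \<subseteq> block_embedding n ` ?K" unfolding T using S(1) by (rule image_mono)
    ultimately show "T \<in> {S. S \<subseteq> block_embedding n ` ?K \<and> S \<noteq> {} \<and> (\<Inter>e\<in>S. zeros e) = {}}"
      by simp
  qed
qed

lemma EZ_dsum_power:
  "EZ (dsum_power lam (Suc m)) (dsum_power lam (Suc n)) = (- 1) ^ (Suc n + m) * int (n choose m)"
proof -
  let ?K = "{B. B \<subseteq> {..<Suc n} \<and> card B = Suc m}"
  have inj: "inj_on (block_embedding (Suc n)) ?K"
    by (rule inj_on_subset[OF inj_on_block_embedding]) auto
  have "inj_on ((`) (block_embedding (Suc n))) {S. S \<subseteq> ?K \<and> \<Union>S = {..<Suc n}}"
    by (rule inj_on_subset[OF inj_on_image_Pow[OF inj]]) auto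
  then have "EZ (dsum_power lam (Suc m)) (dsum_power lam (Suc n)) =
      (\<Sum>S | S \<subseteq> ?K \<and> \<Union>S = {..<Suc n}. (- 1) ^ card (block_embedding (Suc n) ` S))"
    by (simp add: EZ_def EZ_sets_dsum_power sum.reindex)
  \<comment> \<open>Distinct sets of summands give distinct embeddings, so families keep their
    cardinality.\<close>
  also have "\<dots> = (\<Sum>S | S \<subseteq> ?K \<and> \<Union>S = {..<Suc n}. (- 1) ^ card S)"
    by (intro sum.cong refl) (simp add: card_image inj_on_subset[OF inj])
  also have "\<dots> = (- 1) ^ (Suc n + m) * int (n choose m)"
    by (rule sum_covering_families) simp_all
  finally show ?thesis .
qed

end

theorem proposition32:
  fixes lam :: "nat list" and m n :: nat
  assumes "is_perm lam"
    and "\<not> decomposable lam"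
    and "length lam > 1"
    and "1 \<le> m"
    and "m \<le> n"
  shows "(of_int (EZ (dsum_power lam m) (dsum_power lam n)) :: rat) =
           (- 1) powi (int n - int m - 1) * of_nat ((n - 1) choose (m - 1))"
proof -
  interpret indecomposable_perm lam by standard (fact assms)+
  obtain k d where m: "m = Suc k" and n: "n = Suc (k + d)"
    using assms(4,5) by (metis Suc_le_D add_Suc le_Suc_ex One_nat_def)
  \<comment> \<open>The exponent is \<open>d - 1\<close>, which is -1 if \<open>m = n\<close>, hence
    the integer power; it has the same parity as \<open>Suc (k + d) + k\<close>.\<close>
  have "(- 1 :: rat) powi (int n - int m - 1) = (- 1) ^ (Suc (k + d) + k)"
    by (cases d) (simp_all add: m n power_int_minus uminus_power_if)
  then show ?thesis
    using EZ_dsum_power[of k "k + d"] by (simp add: m n del: power_Suc)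
qed

end
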